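(* Let $\mathcal{X},\mathcal{Z}$ be finite sets, let $P_{XZ}$ be a probability distribution on $\mathcal{X}\times\mathcal{Z}$, and for each $n\ge 1$ let $(X^n,Z^n)=((X_1,Z_1),\dots,(X_n,Z_n))$ be i.i.d. with common distribution $P_{XZ}$. Assume that $\sigma^2=\mathrm{Var}\left[\log\frac{1}{P_{X|Z}(X|Z)}\right]$ is positive, and put $\sigma=\sqrt{\sigma^2}$. Let $f_n:\mathcal{X}^n\to\mathcal{M}_n=\{1,\dots,M_n\}$, $n=1,2,\dots$, be a sequence of functions such that $$\lim_{n\to\infty}\frac{1}{n}\log M_n=H(X|Z),$$ and let $$b=\liminf_{n\to\infty}\frac{1}{\sqrt{n}}\log\frac{M_n}{e^{nH(X|Z)}}\in[-\infty,\infty].$$ Then $$\liminf_{n\to\infty}\frac{1}{\sqrt{n}}D(f_n)\ \ge\ \int_{-\infty}^{b/\sigma}(b-\sigma u)\,g(u)\,du,\qquad g(u)=\frac{1}{\sqrt{2\pi}}e^{-u^2/2},$$ where the right-hand side is understood as $+\infty$ if $b=+\infty$ and as $0$ if $b=-\infty$.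
   Context: All logarithms are natural (base $e$). $M_n$ is a positive integer. $H(X|Z)$ is the conditional Shannon entropy for $P_{XZ}$. For a function $f_n:\mathcal{X}^n\to\mathcal{M}_n$, put $S_n=f_n(X^n)$, so $P_{S_nZ^n}(s,z^n)=\sum_{x^n\in f_n^{-1}(s)}P_{X^nZ^n}(x^n,z^n)$. Let $P_{U_n}$ be the uniform distribution on $\mathcal{M}_n$. Define $D(f_n)=D(P_{S_nZ^n}\,\|\,P_{U_n}\times P_{Z^n})$, where $D(P\|Q)=\sum_a P(a)\log\frac{P(a)}{Q(a)}$ is the Kullback–Leibler divergence (with $0\log 0=0$). *)

theory Defs
  imports "HOL-Probability.Probability"
begin

text \<open>
  A single-letter law \<open>P\<^sub>X\<^sub>Z\<close> is a \<open>pmf\<close> \<open>p\<close> on \<open>'a \<times> 'b\<close>, where \<open>'a\<close> and \<open>'b\<close> are finite types.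
  All information quantities use base \<open>exp 1\<close>.
\<close>

definition cond_pmf_at :: "('a \<times> 'b) pmf \<Rightarrow> 'a \<Rightarrow> 'b \<Rightarrow> real" where
  "cond_pmf_at p x z = pmf p (x, z) / pmf (map_pmf snd p) z"

definition cond_entropy :: "('a::finite \<times> 'b::finite) pmf \<Rightarrow> real" where
  "cond_entropy p = prob_space.conditional_entropy (measure_pmf p) (exp 1)
     (count_space UNIV) (count_space UNIV) fst snd"

definition info_variance :: "('a::finite \<times> 'b::finite) pmf \<Rightarrow> real" where
  "info_variance p = measure_pmf.variance p (\<lambda>(x, z). ln (1 / cond_pmf_at p x z))"

text \<open>
  Sequences \<open>x\<^sup>n\<close>, \<open>z\<^sup>n\<close> are lists of length \<open>n\<close>. A sample of \<open>replicate_pmf n p\<close> is the list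
  of the pairs \<open>(X\<^sub>i, Z\<^sub>i)\<close>, \<open>i = 1, \<dots>, n\<close>.
\<close>

definition hash_joint :: "('a \<times> 'b) pmf \<Rightarrow> nat \<Rightarrow> ('a list \<Rightarrow> nat) \<Rightarrow> (nat \<times> 'b list) pmf" where
  "hash_joint p n f = map_pmf (\<lambda>xz. (f (map fst xz), map snd xz)) (replicate_pmf n p)"

definition hash_ideal :: "('a \<times> 'b) pmf \<Rightarrow> nat \<Rightarrow> nat \<Rightarrow> (nat \<times> 'b list) pmf" where
  "hash_ideal p n m = pair_pmf (pmf_of_set {1..m}) (map_pmf (map snd) (replicate_pmf n p))"

text \<open>
  In \<open>KL_divergence b Q P\<close> the reference measure \<open>Q\<close> is the first measure argument,
  so it denotes \<open>D(P \<parallel> Q)\<close>.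
\<close>

definition hash_divergence :: "('a \<times> 'b) pmf \<Rightarrow> nat \<Rightarrow> nat \<Rightarrow> ('a list \<Rightarrow> nat) \<Rightarrow> real" where
  "hash_divergence p n m f =
     KL_divergence (exp 1) (measure_pmf (hash_ideal p n m)) (measure_pmf (hash_joint p n f))"


text \<open>The remaining lemmas unfold these notions to the elementary finite formulas.\<close>

lemma cond_entropy_eq:
  "cond_entropy p = (\<Sum>(x, z)\<in>UNIV. pmf p (x, z) * ln (1 / cond_pmf_at p x z))"
proof -
  interpret information_space "measure_pmf p" "exp 1"
    by unfold_locales simp
  have 1: "distributed (measure_pmf p) (count_space UNIV) snd (\<lambda>z. ennreal (pmf (map_pmf snd p) z))"
    unfolding distributed_def
    by (auto simp: measure_pmf_eq_density[symmetric] map_pmf_rep_eq[symmetric])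
  have c: "count_space UNIV \<Otimes>\<^sub>M count_space UNIV = (count_space UNIV :: ('a \<times> 'b) measure)"
    by (simp add: pair_measure_count_space)
  have 2: "distributed (measure_pmf p) (count_space UNIV \<Otimes>\<^sub>M count_space UNIV)
      (\<lambda>x. (fst x, snd x)) (\<lambda>xz. ennreal (pmf p xz))"
    unfolding distributed_def c
    by (auto simp: map_pmf_rep_eq[symmetric] measure_pmf_eq_density[symmetric])
  have "cond_entropy p = - (\<integral>(x, z). pmf p (x, z) * log (exp 1) (pmf p (x, z) / pmf (map_pmf snd p) z)
      \<partial>(count_space UNIV \<Otimes>\<^sub>M count_space UNIV))"
    unfolding cond_entropy_def
    by (rule conditional_entropy_generic_eq[OF _ _ 1 _ 2])
       (simp_all add: sigma_finite_measure_count_space_finite)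
  also have "\<dots> = - (\<Sum>(x, z)\<in>UNIV. pmf p (x, z) * ln (cond_pmf_at p x z))"
    by (simp add: c lebesgue_integral_count_space_finite cond_pmf_at_def log_def)
  also have "\<dots> = (\<Sum>(x, z)\<in>UNIV. pmf p (x, z) * ln (1 / cond_pmf_at p x z))"
    unfolding sum_negf[symmetric]
  proof (rule sum.cong[OF refl], clarify)
    fix x z
    show "- (pmf p (x, z) * ln (cond_pmf_at p x z)) = pmf p (x, z) * ln (1 / cond_pmf_at p x z)"
    proof (cases "cond_pmf_at p x z = 0")
      case False
      then have "cond_pmf_at p x z > 0"
        by (simp add: cond_pmf_at_def pmf_nonneg less_le)
      then show ?thesis by (simp add: ln_div)
    qed simp
  qed
  finally show ?thesis .
qed

lemma cond_entropy_eq_expectation: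
  "cond_entropy p = measure_pmf.expectation p (\<lambda>(x, z). ln (1 / cond_pmf_at p x z))"
  unfolding cond_entropy_eq
  by (subst integral_measure_pmf_real[of UNIV])
     (auto intro!: sum.cong simp: mult.commute)

lemma pmf_replicate_pmf:
  "pmf (replicate_pmf n p) xs = (if length xs = n then \<Prod>x\<leftarrow>xs. pmf p x else 0)"
proof (induction n arbitrary: xs)
  case 0
  then show ?case by (auto simp: pmf_return)
next
  case (Suc n)
  have eq: "replicate_pmf (Suc n) p = map_pmf (\<lambda>(x, xs). x # xs) (pair_pmf p (replicate_pmf n p))"
    by (simp add: pair_pmf_def map_bind_pmf)
  have inj: "inj (\<lambda>(x, xs). x # xs :: 'a list)"
    by (auto simp: inj_on_def)
  show ?case
  proof (cases xs)
    case Nil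
    then show ?thesis unfolding eq by (auto simp: pmf_eq_0_set_pmf)
  next
    case (Cons y ys)
    then have "pmf (replicate_pmf (Suc n) p) xs = pmf (pair_pmf p (replicate_pmf n p)) (y, ys)"
      unfolding eq using pmf_map_inj'[OF inj, of _ "(y, ys)"] by simp
    with Cons Suc show ?thesis by (simp add: pmf_pair)
  qed
qed

lemma hash_joint_support: "set_pmf (hash_joint p n f) \<subseteq> set_pmf (hash_ideal p n m)"
  if "m > 0" "\<And>xs. length xs = n \<Longrightarrow> f xs \<in> {1..m}"
  using that by (fastforce simp: hash_joint_def hash_ideal_def set_replicate_pmf)

lemma pmf_hash_joint:
  fixes p :: "('a::finite \<times> 'b::finite) pmf"
  assumes "length zs = n"
  shows "pmf (hash_joint p n f) (s, zs) =
    (\<Sum>xs | length xs = n \<and> f xs = s. \<Prod>i<n. pmf p (xs ! i, zs ! i))"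
proof -
  let ?A = "{xs. length xs = n \<and> f xs = s}"
  have fin: "finite ?A"
    by (rule finite_subset[OF _ finite_lists_length_eq[of UNIV n]]) auto
  have "pmf (hash_joint p n f) (s, zs) =
      measure (replicate_pmf n p) {xz. f (map fst xz) = s \<and> map snd xz = zs}"
    unfolding hash_joint_def pmf_map by (simp add: vimage_def)
  also have "\<dots> = measure (replicate_pmf n p) ((\<lambda>xs. zip xs zs) ` ?A)"
  proof (rule measure_pmf.finite_measure_eq_AE)
    have "xz \<in> (\<lambda>xs. zip xs zs) ` ?A" if "f (map fst xz) = s" "map snd xz = zs" for xz
      using that assms by (intro image_eqI[of _ _ "map fst xz"]) (auto simp: zip_map_fst_snd)
    then show "AE xz in replicate_pmf n p. (xz \<in> {xz. f (map fst xz) = s \<and> map snd xz = zs}) =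
        (xz \<in> (\<lambda>xs. zip xs zs) ` ?A)"
      using assms by (auto simp: AE_measure_pmf_iff)
  qed auto
  also have "\<dots> = (\<Sum>xz\<in>(\<lambda>xs. zip xs zs) ` ?A. pmf (replicate_pmf n p) xz)"
    using fin by (intro measure_measure_pmf_finite) simp
  also have "\<dots> = (\<Sum>xs\<in>?A. pmf (replicate_pmf n p) (zip xs zs))"
    using assms by (intro sum.reindex[unfolded o_def] inj_onI) (metis (mono_tags, lifting) map_fst_zip mem_Collect_eq)
  also have "\<dots> = (\<Sum>xs\<in>?A. \<Prod>i<n. pmf p (xs ! i, zs ! i))"
    using assms by (intro sum.cong refl)
      (auto simp: pmf_replicate_pmf prod.list_conv_set_nth atLeast0LessThan)
  finally show ?thesis .
qed

lemma KL_divergence_pmf: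
  assumes "finite (set_pmf P)" "set_pmf P \<subseteq> set_pmf Q"
  shows "KL_divergence (exp 1) (measure_pmf Q) (measure_pmf P) =
    (\<Sum>a\<in>set_pmf P. pmf P a * ln (pmf P a / pmf Q a))"
proof -
  let ?r = "\<lambda>x. pmf P x / pmf Q x"
  have dens: "measure_pmf P = density (measure_pmf Q) (\<lambda>x. ennreal (?r x))"
    unfolding measure_pmf_eq_density[of P] measure_pmf_eq_density[of Q]
  proof (subst density_density_eq; (intro density_cong)?)
    have "ennreal (pmf P x) = ennreal (pmf Q x) * ennreal (?r x)" for x
    proof (cases "x \<in> set_pmf Q")
      case True
      then have "pmf Q x \<noteq> 0" by (simp add: set_pmf_iff)
      then show ?thesis by (simp flip: ennreal_mult)
    next
      case False
      with assms(2) have "pmf P x = 0" "pmf Q x = 0" by (auto simp: set_pmf_iff)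
      then show ?thesis by simp
    qed
    then show "AE x in count_space UNIV. ennreal (pmf P x) = ennreal (pmf Q x) * ennreal (?r x)"
      by simp
  qed auto
  have "KL_divergence (exp 1) (measure_pmf Q) (measure_pmf P) =
      (\<integral>x. ?r x * log (exp 1) (?r x) \<partial>measure_pmf Q)"
    unfolding dens 
    by (rule sigma_finite_measure.KL_density) (auto intro: measure_pmf.sigma_finite_measure_axioms)
  also have "\<dots> = (\<Sum>a\<in>set_pmf P. (?r a * log (exp 1) (?r a)) * pmf Q a)"
    using assms(1) by (intro integral_measure_pmf_real) (auto simp: set_pmf_iff)
  also have "\<dots> = (\<Sum>a\<in>set_pmf P. pmf P a * ln (pmf P a / pmf Q a))"
  proof (rule sum.cong[OF refl])
    fix a assume "a \<in> set_pmf P"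
    with assms(2) have "pmf Q a \<noteq> 0" by (auto simp: set_pmf_iff)
    then show "(?r a * log (exp 1) (?r a)) * pmf Q a = pmf P a * ln (pmf P a / pmf Q a)"
      by (simp add: log_def)
  qed
  finally show ?thesis .
qed

lemma hash_divergence_eq:
  fixes p :: "('a::finite \<times> 'b::finite) pmf"
  assumes m: "m > 0" and f: "\<And>xs. length xs = n \<Longrightarrow> f xs \<in> {1..m}"
  shows "hash_divergence p n m f =
    (\<Sum>(s, zs)\<in>{1..m} \<times> {zs. length zs = n}.
       pmf (hash_joint p n f) (s, zs) *
       ln (pmf (hash_joint p n f) (s, zs) /
           (1 / real m * pmf (map_pmf (map snd) (replicate_pmf n p)) zs)))"
proof -
  have sub: "set_pmf (hash_joint p n f) \<subseteq> {1..m} \<times> {zs. length zs = n}"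
    using f by (fastforce simp: hash_joint_def set_replicate_pmf)
  have fin: "finite ({1..m} \<times> {zs :: 'b list. length zs = n})"
    using finite_lists_length_eq[of "UNIV :: 'b set" n] by simp
  have "hash_divergence p n m f = (\<Sum>a\<in>set_pmf (hash_joint p n f). pmf (hash_joint p n f) a *
      ln (pmf (hash_joint p n f) a / pmf (hash_ideal p n m) a))"
    unfolding hash_divergence_def 
    by (rule KL_divergence_pmf[OF finite_subset[OF sub fin] hash_joint_support[OF m f]])
  also have "\<dots> = (\<Sum>a\<in>{1..m} \<times> {zs. length zs = n}. pmf (hash_joint p n f) a *
      ln (pmf (hash_joint p n f) a / pmf (hash_ideal p n m) a))"
    using sub fin by (intro sum.mono_neutral_left) (auto simp: pmf_eq_0_set_pmf)
  also have "\<dots> = (\<Sum>(s, zs)\<in>{1..m} \<times> {zs. length zs = n}.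
       pmf (hash_joint p n f) (s, zs) *
       ln (pmf (hash_joint p n f) (s, zs) /
           (1 / real m * pmf (map_pmf (map snd) (replicate_pmf n p)) zs)))"
    using m by (intro sum.cong refl) (auto simp: hash_ideal_def pmf_pair)
  finally show ?thesis .
qed

end

theory Submission
  imports Defs "HOL-Real_Asymp.Real_Asymp"
begin

text \<open>
  Since \<open>S\<close> is a function of \<open>X\<^sup>n\<close>, \<open>P(S | Z\<^sup>n) \<ge> P(X\<^sup>n | Z\<^sup>n)\<close>, so the
  positive part of \<open>ln (M\<^sub>n P(S | Z\<^sup>n))\<close> is at least that of \<open>ln M\<^sub>n - (\<Sum>i. ln (1 / P(X\<^sub>i | Z\<^sub>i)))\<close>,
  while the negative part contributes at most \<open>1\<close> to the divergence because \<open>t ln t \<ge> t - 1\<close>.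
  After division by \<open>sqrt n\<close> the lower bound becomes the expectation of \<open>max 0 (b\<^sub>n - \<sigma> U\<^sub>n)\<close>,
  where \<open>U\<^sub>n\<close> is the standardized sum of the conditional information. By the central limit theorem,
  applied to truncations of this function of \<open>U\<^sub>n\<close>, the limit inferior of this expectation
  is at least the expectation of \<open>max 0 (r - \<sigma> U)\<close>, \<open>U\<close> standard normal, for every \<open>r < b\<close>.
\<close>

section \<open>Weak convergence of standardized sums over an i.i.d. list\<close>

lemma finite_set_replicate_pmf:
  fixes p :: "'c::finite pmf"
  shows "finite (set_pmf (replicate_pmf n p))"
  using finite_lists_length_eq[of "UNIV :: 'c set" n]
  by (rule finite_subset[rotated]) (auto simp: set_replicate_pmf)

text \<open>The head of the list is independent of the tail, so averaging over it splits off one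
  factor of the exponential.\<close>

lemma char_sum_list_replicate_pmf:
  fixes p :: "'c::finite pmf" and h :: "'c \<Rightarrow> real"
  shows "char (distr (replicate_pmf n p) borel (\<lambda>xs. sum_list (map h xs))) t =
    char (distr p borel h) t ^ n"
proof (induction n)
  case 0
  then show ?case by (simp add: char_def integral_distr)
next
  case (Suc n)
  let ?c = "\<lambda>xs. iexp (t * sum_list (map h xs))"
  have "measure_pmf.expectation (replicate_pmf (Suc n) p) ?c =
      (\<Sum>x\<in>UNIV. pmf p x *\<^sub>R measure_pmf.expectation (replicate_pmf n p) (\<lambda>xs. ?c (x # xs)))"
    by (simp add: pmf_expectation_bind[of UNIV] finite_set_replicate_pmf flip: map_pmf_def)
  also have "\<dots> = (\<Sum>x\<in>UNIV. pmf p x *\<^sub>R iexp (t * h x)) *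
      measure_pmf.expectation (replicate_pmf n p) ?c"
    by (simp add: distrib_left exp_add sum_distrib_right)
  also have "(\<Sum>x\<in>UNIV. pmf p x *\<^sub>R iexp (t * h x)) = measure_pmf.expectation p (\<lambda>x. iexp (t * h x))"
    by (subst integral_measure_pmf[of UNIV]) auto
  finally show ?case
    using Suc by (simp add: char_def integral_distr)
qed

text \<open>The family of all coordinates is the identity map on the product space, so its joint law
  is the product of the marginal laws, which is independence.\<close>

lemma indep_vars_PiM_component:
  assumes "\<And>i. prob_space (M i)"
  shows "prob_space.indep_vars (PiM UNIV M) M (\<lambda>i \<omega>. \<omega> i) UNIV"
proof -
  interpret prob_space "PiM UNIV M"
    by (intro prob_space_PiM assms)
  show ?thesis
    by (subst indep_vars_iff_distr_eq_PiM)
      (simp_all add: distr_PiM_component assms restrict_UNIV distr_id)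
qed

text \<open>The probability space \<open>replicate_pmf n p\<close> changes with \<open>n\<close>,
  while the classical theorem concerns one infinite independent sequence. The proof therefore works
  on an infinite product and transfers only the laws of the partial sums.\<close>

lemma central_limit_theorem_replicate_pmf:
  fixes p :: "'c::finite pmf" and h :: "'c \<Rightarrow> real"
  assumes pos: "measure_pmf.variance p h > 0"
  defines "m \<equiv> measure_pmf.expectation p h"
  shows "weak_conv_m (\<lambda>n. distr (replicate_pmf n p) borel
      (\<lambda>xs. (\<Sum>x\<leftarrow>xs. h x - m) / sqrt (real n * measure_pmf.variance p h))) std_normal_distribution"
proof -
  let ?v = "measure_pmf.variance p h"
  define h' where "h' x = h x - m" for x
  define \<mu> where "\<mu> = distr p borel h'"
  define \<Omega> where "\<Omega> = PiM UNIV (\<lambda>_::nat. \<mu>)"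
  have sets_\<mu> [measurable_cong, simp]: "sets \<mu> = sets borel" by (simp add: \<mu>_def)
  interpret \<mu>: prob_space \<mu>
    unfolding \<mu>_def by (rule measure_pmf.prob_space_distr) simp
  interpret \<Omega>: prob_space \<Omega>
    unfolding \<Omega>_def by (intro prob_space_PiM) unfold_locales
  have [measurable]: "(\<lambda>\<omega>. \<omega> i) \<in> borel_measurable \<Omega>" for i
    unfolding \<Omega>_def by measurable
  have d: "distr \<Omega> borel (\<lambda>\<omega>. \<omega> i) = \<mu>" for i
    using distr_PiM_component[of UNIV "\<lambda>_. \<mu>" i]
    by (simp add: \<Omega>_def \<mu>.prob_space_axioms cong: distr_cong)
  have indep: "\<Omega>.indep_vars (\<lambda>_. borel) (\<lambda>i \<omega>. \<omega> i) UNIV"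
    using indep_vars_PiM_component[of "\<lambda>_::nat. \<mu>", OF \<mu>.prob_space_axioms]
    unfolding \<Omega>_def[symmetric] by (rule \<Omega>.indep_vars_compose2[where Y = "\<lambda>_ x. x"])
      (simp cong: measurable_cong_sets)
  have int: "integrable p k" for k :: "'c \<Rightarrow> real"
    by (rule integrable_measure_pmf_finite) simp
  have E: "\<Omega>.expectation (\<lambda>\<omega>. k (\<omega> i)) = measure_pmf.expectation p (\<lambda>x. k (h' x))"
    and I: "integrable \<Omega> (\<lambda>\<omega>. k (\<omega> i))"
    if [measurable]: "k \<in> borel_measurable borel" for k :: "real \<Rightarrow> real" and i
  proof -
    have "\<Omega>.expectation (\<lambda>\<omega>. k (\<omega> i)) = integral\<^sup>L (distr \<Omega> borel (\<lambda>\<omega>. \<omega> i)) k"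
      by (simp add: integral_distr)
    then show "\<Omega>.expectation (\<lambda>\<omega>. k (\<omega> i)) = measure_pmf.expectation p (\<lambda>x. k (h' x))"
      by (simp add: d \<mu>_def integral_distr)
    have "integrable (distr \<Omega> borel (\<lambda>\<omega>. \<omega> i)) k"
      unfolding d \<mu>_def by (simp add: integrable_distr_eq int)
    then show "integrable \<Omega> (\<lambda>\<omega>. k (\<omega> i))"
      by (simp add: integrable_distr_eq)
  qed
  have m0: "measure_pmf.expectation p h' = 0"
    by (simp add: h'_def[abs_def] m_def int)
  have "weak_conv_m (\<lambda>n. distr \<Omega> borel (\<lambda>\<omega>. (\<Sum>i<n. \<omega> i) / sqrt (real n * (sqrt ?v)\<^sup>2)))
      std_normal_distribution"
    by (rule \<Omega>.central_limit_theorem_zero_mean[OF indep _ _ _ _ d])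
      (use pos m0 in \<open>simp_all add: E[of "\<lambda>x. x"] E[of "\<lambda>x. x\<^sup>2"] I[of "\<lambda>x. x\<^sup>2"], 
        simp_all add: h'_def[abs_def] m_def\<close>)
  \<comment> \<open>Both sides have as characteristic function the \<open>n\<close>-th power of that
    of \<open>\<mu>\<close>, so Levy uniqueness identifies the laws.\<close>
  moreover have "distr \<Omega> borel (\<lambda>\<omega>. \<Sum>i<n. \<omega> i) =
      distr (replicate_pmf n p) borel (\<lambda>xs. sum_list (map h' xs))" for n
  proof (rule Levy_uniqueness)
    show "char (distr \<Omega> borel (\<lambda>\<omega>. \<Sum>i<n. \<omega> i)) =
        char (distr (replicate_pmf n p) borel (\<lambda>xs. sum_list (map h' xs)))"
    proof
      fix t
      show "char (distr \<Omega> borel (\<lambda>\<omega>. \<Sum>i<n. \<omega> i)) t =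
          char (distr (replicate_pmf n p) borel (\<lambda>xs. sum_list (map h' xs))) t"
        unfolding char_sum_list_replicate_pmf
        by (subst \<Omega>.char_distr_sum[OF \<Omega>.indep_vars_subset[OF indep]]) (simp_all add: d \<mu>_def)
    qed
  qed (simp_all add: real_distribution_def real_distribution_axioms_def
      \<Omega>.prob_space_distr measure_pmf.prob_space_distr)
  then have "distr (distr \<Omega> borel (\<lambda>\<omega>. \<Sum>i<n. \<omega> i)) borel (\<lambda>s. s / sqrt (real n * ?v)) =
      distr (distr (replicate_pmf n p) borel (\<lambda>xs. sum_list (map h' xs))) borel
        (\<lambda>s. s / sqrt (real n * ?v))" for n
    by simp
  then have "distr \<Omega> borel (\<lambda>\<omega>. (\<Sum>i<n. \<omega> i) / sqrt (real n * ?v)) =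
      distr (replicate_pmf n p) borel (\<lambda>xs. sum_list (map h' xs) / sqrt (real n * ?v))" for n
    by (simp add: distr_distr comp_def)
  ultimately show ?thesis
    using pos by (simp add: h'_def[abs_def] less_imp_le)
qed

section \<open>A lower bound on the divergence at fixed block length\<close>

lemma map_replicate_pmf:
  "map_pmf (map h) (replicate_pmf n p) = replicate_pmf n (map_pmf h p)"
proof (induction n)
  case (Suc n)
  show ?case
    unfolding replicate_pmf.simps Suc.IH[symmetric]
    by (simp add: map_pmf_def bind_assoc_pmf bind_return_pmf)
qed simp

lemma prod_list_divide:
  fixes u v :: "'a \<Rightarrow> 'b::field"
  shows "(\<Prod>x\<leftarrow>xs. u x / v x) = (\<Prod>x\<leftarrow>xs. u x) / (\<Prod>x\<leftarrow>xs. v x)"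
  by (induction xs) simp_all

lemma ln_prod_list:
  fixes u :: "'a \<Rightarrow> real"
  assumes "\<And>x. x \<in> set xs \<Longrightarrow> u x > 0"
  shows "(\<Prod>x\<leftarrow>xs. u x) > 0 \<and> ln (\<Prod>x\<leftarrow>xs. u x) = (\<Sum>x\<leftarrow>xs. ln (u x))"
  using assms by (induction xs) (auto simp: ln_mult_pos)

text \<open>When the logarithm is negative, \<open>ln t \<le> t - 1\<close> at
  \<open>t = q / a\<close> shows that the term is at least \<open>a - q\<close>, so replacing it by
  zero costs at most \<open>q\<close>. The third assumption is pointwise absolute
  continuity.\<close>

lemma mult_ln_quotient_ge:
  fixes a q :: real
  assumes "a \<ge> 0" "q \<ge> 0" "q = 0 \<Longrightarrow> a = 0"
  shows "a * ln (a / q) \<ge> a * max 0 (ln (a / q)) - q"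
proof (cases "a = 0 \<or> ln (a / q) \<ge> 0")
  case True
  then show ?thesis using assms by (auto simp: max_def)
next
  case False
  then have pos: "a > 0" "q > 0" using assms by (auto simp: less_le)
  have "ln (q / a) \<le> q / a - 1"
    using pos by (intro ln_le_minus_one) simp
  then have "a * ln (q / a) \<le> q - a"
    using pos by (simp add: field_simps)
  moreover have "ln (a / q) = - ln (q / a)"
    using pos by (simp add: ln_div)
  ultimately show ?thesis using False pos by (simp add: max_def)
qed

text \<open>Conditional self-information: under \<open>p\<close> its mean is
  \<open>cond_entropy p\<close> and its variance \<open>info_variance p\<close>.\<close>

definition cond_info :: "('a \<times> 'b) pmf \<Rightarrow> 'a \<times> 'b \<Rightarrow> real" where
  "cond_info p = (\<lambda>(x, z). ln (1 / cond_pmf_at p x z))"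

text \<open>\<open>mult_ln_quotient_ge\<close> is applied to every pair, with the joint mass as
  \<open>a\<close> and the ideal mass as \<open>q\<close>; the ideal masses sum to 1, which is the
  constant lost. The surviving positive part is then bounded below sequence by sequence.\<close>

lemma hash_divergence_ge:
  fixes p :: "('a::finite \<times> 'b::finite) pmf"
  assumes m: "m > 0" and f: "\<And>xs. length xs = n \<Longrightarrow> f xs \<in> {1..m}"
  shows "hash_divergence p n m f \<ge>
    measure_pmf.expectation (replicate_pmf n p) (\<lambda>xz. max 0 (ln (real m) - (\<Sum>v\<leftarrow>xz. cond_info p v))) - 1"
proof -
  let ?R = "replicate_pmf n p"
  let ?A = "{1..m} \<times> {zs :: 'b list. length zs = n}"
  define J where "J = hash_joint p n f"
  define Z where "Z = map_pmf (map snd) ?R"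
  define k where "k a = ln (pmf J a / (1 / real m * pmf Z (snd a)))" for a
  have finz: "finite {zs :: 'b list. length zs = n}"
    using finite_lists_length_eq[of "UNIV :: 'b set" n] by simp
  have subJ: "set_pmf J \<subseteq> ?A"
    using f by (fastforce simp: J_def hash_joint_def set_replicate_pmf)
  \<comment> \<open>Holds because \<open>Z\<close> is the second marginal of \<open>J\<close>; this
    is the absolute continuity that \<open>mult_ln_quotient_ge\<close> asks for.\<close>
  have J0: "pmf J a = 0" if "pmf Z (snd a) = 0" for a
  proof -
    have "Z = map_pmf snd J"
      by (simp add: J_def Z_def hash_joint_def map_pmf_comp)
    with that have "snd a \<notin> snd ` set_pmf J"
      by (simp add: pmf_eq_0_set_pmf)
    then have "a \<notin> set_pmf J"
      by blast
    then show ?thesis by (simp add: pmf_eq_0_set_pmf)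
  qed
  have sumZ: "(\<Sum>zs | length zs = n. pmf Z zs) = 1"
    by (rule sum_pmf_eq_1[OF finz]) (auto simp: Z_def set_replicate_pmf)
  have D: "hash_divergence p n m f = (\<Sum>a\<in>?A. pmf J a * k a)"
    by (subst hash_divergence_eq[OF m], erule f, intro sum.cong) (auto simp: J_def Z_def k_def)
  have pos_part: "(\<Sum>a\<in>?A. pmf J a * max 0 (k a) - 1 / real m * pmf Z (snd a)) \<le>
      (\<Sum>a\<in>?A. pmf J a * k a)"
    unfolding k_def by (intro sum_mono mult_ln_quotient_ge) (use m J0 in auto)
  have "(\<Sum>a\<in>?A. pmf J a * max 0 (k a) - 1 / real m * pmf Z (snd a)) =
      (\<Sum>a\<in>?A. pmf J a * max 0 (k a)) - (\<Sum>s\<in>{1..m}. \<Sum>zs | length zs = n. 1 / real m * pmf Z zs)"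
    unfolding sum_subtractf sum.cartesian_product by (simp add: case_prod_unfold)
  also have "(\<Sum>s\<in>{1..m}. \<Sum>zs | length zs = n. 1 / real m * pmf Z zs) = 1"
    using m sumZ by (simp flip: sum_distrib_left sum_divide_distrib)
  also have "(\<Sum>a\<in>?A. pmf J a * max 0 (k a)) = measure_pmf.expectation J (\<lambda>a. max 0 (k a))"
    using subJ finz by (subst integral_measure_pmf_real[of ?A]) (auto simp: mult.commute)
  also have "\<dots> = measure_pmf.expectation ?R (\<lambda>xz. max 0 (k (f (map fst xz), map snd xz)))"
    by (simp add: J_def hash_joint_def)
  finally have split: "(\<Sum>a\<in>?A. pmf J a * max 0 (k a) - 1 / real m * pmf Z (snd a)) =
      measure_pmf.expectation ?R (\<lambda>xz. max 0 (k (f (map fst xz), map snd xz))) - 1" .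
  have "measure_pmf.expectation ?R (\<lambda>xz. max 0 (ln (real m) - (\<Sum>v\<leftarrow>xz. cond_info p v))) \<le>
      measure_pmf.expectation ?R (\<lambda>xz. max 0 (k (f (map fst xz), map snd xz)))"
  proof (rule integral_mono_AE)
    show "AE xz in ?R. max 0 (ln (real m) - (\<Sum>v\<leftarrow>xz. cond_info p v)) \<le>
        max 0 (k (f (map fst xz), map snd xz))"
    proof (rule AE_pmfI)
      fix xz assume xz: "xz \<in> set_pmf ?R"
      let ?c = "\<lambda>v. cond_pmf_at p (fst v) (snd v)"
      have len: "length xz = n" and supp: "set xz \<subseteq> set_pmf p"
        using xz by (auto simp: set_replicate_pmf)
      \<comment> \<open>On the support every single-letter conditional probability is positive, so
        the logarithms below are genuine and additive.\<close>
      have cpos: "?c v > 0" if "v \<in> set xz" for v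
      proof -
        have "v \<in> set_pmf p" using that supp by auto
        then have "pmf p v > 0" "pmf (map_pmf snd p) (snd v) > 0"
          by (auto simp: pmf_positive)
        then show ?thesis by (simp add: cond_pmf_at_def)
      qed
      \<comment> \<open>The second marginal is again i.i.d., hence the product of the letterwise
        conditional probabilities is the conditional probability of the whole block.\<close>
      have "pmf Z (map snd xz) = (\<Prod>v\<leftarrow>xz. pmf (map_pmf snd p) (snd v))"
        unfolding Z_def map_replicate_pmf using len by (simp add: pmf_replicate_pmf comp_def)
      then have c: "(\<Prod>v\<leftarrow>xz. ?c v) = pmf ?R xz / pmf Z (map snd xz)"
        unfolding cond_pmf_at_def prod_list_divide using len by (simp add: pmf_replicate_pmf)
      have "map snd xz \<in> set_pmf Z" using xz by (auto simp: Z_def)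
      then have Zpos: "pmf Z (map snd xz) > 0" by (rule pmf_positive)
      \<comment> \<open>The event that hash and side information take these values contains the
        outcome \<open>xz\<close>, because the hash is a deterministic function of the
        block.\<close>
      have "pmf ?R xz \<le> pmf J (f (map fst xz), map snd xz)"
        unfolding J_def hash_joint_def pmf_map[of _ ?R] 
        by (subst measure_pmf_single[symmetric], rule measure_pmf.finite_measure_mono) auto
      then have "real m * (\<Prod>v\<leftarrow>xz. ?c v) \<le>
          pmf J (f (map fst xz), map snd xz) / (1 / real m * pmf Z (map snd xz))"
        unfolding c using m Zpos by (simp add: field_simps)
      moreover have "0 < real m * (\<Prod>v\<leftarrow>xz. ?c v)"
        using m ln_prod_list[of xz ?c] cpos by simp
      ultimately have "ln (real m * (\<Prod>v\<leftarrow>xz. ?c v)) \<le> k (f (map fst xz), map snd xz)"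
        unfolding k_def by (simp add: ln_mono)
      moreover have "ln (real m * (\<Prod>v\<leftarrow>xz. ?c v)) = ln (real m) + (\<Sum>v\<leftarrow>xz. ln (?c v))"
        using m ln_prod_list[of xz ?c] cpos by (simp add: ln_mult_pos)
      moreover have "(\<Sum>v\<leftarrow>xz. cond_info p v) = (\<Sum>v\<leftarrow>xz. - ln (?c v))"
        using cpos by (intro arg_cong[of _ _ sum_list] map_cong)
          (auto simp: cond_info_def case_prod_unfold ln_div)
      ultimately show "max 0 (ln (real m) - (\<Sum>v\<leftarrow>xz. cond_info p v)) \<le>
          max 0 (k (f (map fst xz), map snd xz))"
        using uminus_sum_list_map[of "\<lambda>v. ln (?c v)" xz] by (simp add: comp_def)
    qed
  qed (intro integrable_measure_pmf_finite finite_set_replicate_pmf)+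
  with D pos_part split show ?thesis by simp
qed

section \<open>The Gaussian limit functional\<close>

lemma integrable_std_normal_affine_pos_part:
  "integrable std_normal_distribution (\<lambda>u. max 0 (r - \<sigma> * u))"
proof -
  have "integrable std_normal_distribution (\<lambda>u. u ^ 1)" "integrable std_normal_distribution (\<lambda>u. u ^ 0 :: real)"
    by (rule integrable_std_normal_distribution_moment)+
  then have "integrable std_normal_distribution (\<lambda>u. r * u ^ 0 - \<sigma> * u ^ 1)"
    by (intro Bochner_Integration.integrable_diff integrable_mult_right)
  then show ?thesis
    by (intro integrable_max) simp_all
qed

text \<open>The right-hand side of the theorem in positive-part form: the domain of integration no
  longer depends on \<open>r\<close>, which makes comparison in \<open>r\<close> and truncation
  direct.\<close>

definition normal_shortfall :: "real \<Rightarrow> real \<Rightarrow> real" where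
  "normal_shortfall \<sigma> r = (LINT u|std_normal_distribution. max 0 (r - \<sigma> * u))"

lemma normal_shortfall_eq:
  assumes "\<sigma> > 0"
  shows "normal_shortfall \<sigma> r =
    (LINT u:{..r / \<sigma>}|lborel. (r - \<sigma> * u) * std_normal_density u)"
  unfolding normal_shortfall_def set_lebesgue_integral_def
  by (subst integral_density)
    (use assms in \<open>auto intro!: Bochner_Integration.integral_cong simp: indicator_def max_def field_simps\<close>)

text \<open>The positive part is 1-Lipschitz. This control from the left carries a bound for all
  \<open>r < b\<close> over to \<open>b\<close> itself.\<close>

lemma normal_shortfall_diff_ge:
  assumes "e \<ge> 0"
  shows "normal_shortfall \<sigma> r - e \<le> normal_shortfall \<sigma> (r - e)"
proof -
  interpret prob_space std_normal_distribution
    by (rule prob_space_normal_density) simp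
  have "normal_shortfall \<sigma> r - e = expectation (\<lambda>u. max 0 (r - \<sigma> * u) - e)"
    unfolding normal_shortfall_def
    using prob_space
    by (subst Bochner_Integration.integral_diff[OF integrable_std_normal_affine_pos_part integrable_const]) simp
  also have "\<dots> \<le> normal_shortfall \<sigma> (r - e)"
    unfolding normal_shortfall_def using assms
    by (intro integral_mono Bochner_Integration.integrable_diff integrable_std_normal_affine_pos_part) auto
  finally show ?thesis .
qed

text \<open>A positive part dominates its argument, and the standard normal has mean zero. Used when
  \<open>b = \<infinity>\<close>.\<close>

lemma normal_shortfall_ge: "r \<le> normal_shortfall \<sigma> r"
proof -
  interpret prob_space std_normal_distribution
    by (rule prob_space_normal_density) simp
  have i: "integrable std_normal_distribution (\<lambda>u. u)"
    using integrable_std_normal_distribution_moment[of 1] by simp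
  have "expectation (\<lambda>u. u) = 0"
    using integral_std_normal_distribution_moment_odd[of 1] by simp
  with i have "r = expectation (\<lambda>u. r - \<sigma> * u)"
    using prob_space by simp
  also have "\<dots> \<le> normal_shortfall \<sigma> r"
    unfolding normal_shortfall_def using i
    by (intro integral_mono Bochner_Integration.integrable_diff integrable_std_normal_affine_pos_part) auto
  finally show ?thesis .
qed

text \<open>Weak convergence is exploited through bounded continuous test functions, so the positive
  part is capped at \<open>k\<close>; the uncapped function is integrable and dominates, which
  allows removing the cap.\<close>

lemma normal_shortfall_truncated_tendsto:
  "(\<lambda>k. LINT u|std_normal_distribution. min (real k) (max 0 (r - \<sigma> * u))) \<longlonglongrightarrow> normal_shortfall \<sigma> r"
  unfolding normal_shortfall_def
proof (rule integral_dominated_convergence[where w = "\<lambda>u. max 0 (r - \<sigma> * u)"])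
  show "AE u in std_normal_distribution.
      (\<lambda>k. min (real k) (max 0 (r - \<sigma> * u))) \<longlonglongrightarrow> max 0 (r - \<sigma> * u)"
  proof (rule AE_I2, rule tendsto_eventually)
    fix u
    show "\<forall>\<^sub>F k in sequentially. min (real k) (max 0 (r - \<sigma> * u)) = max 0 (r - \<sigma> * u)"
      using filterlim_real_sequentially[unfolded filterlim_at_top]
      by (auto simp: min_absorb2 elim!: allE[of _ "max 0 (r - \<sigma> * u)"] eventually_mono)
  qed
qed (auto intro!: integrable_std_normal_affine_pos_part)

section \<open>Passage to the limit in the block length\<close>

text \<open>The bound of \<open>hash_divergence_ge\<close> is divided by
  \<open>sqrt (real n)\<close> and centred, so that the standardized sum appears and
  \<open>m\<close> enters only through the threshold \<open>r\<close>.\<close>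

lemma hash_divergence_normalized_ge:
  fixes p :: "('a::finite \<times> 'b::finite) pmf"
  assumes n: "n > 0" and m: "m > 0" and f: "\<And>xs. length xs = n \<Longrightarrow> f xs \<in> {1..m}"
    and var: "info_variance p > 0"
    and r: "r \<le> 1 / sqrt (real n) * ln (real m / exp (real n * cond_entropy p))"
  shows "measure_pmf.expectation (replicate_pmf n p)
      (\<lambda>xz. max 0 (r - sqrt (info_variance p) *
        ((\<Sum>v\<leftarrow>xz. cond_info p v - cond_entropy p) / sqrt (real n * info_variance p)))) - 1 / sqrt (real n)
    \<le> 1 / sqrt (real n) * hash_divergence p n m f"
proof -
  let ?R = "replicate_pmf n p"
  let ?H = "cond_entropy p"
  let ?t = "sqrt (real n)"
  have t: "?t > 0" "?t * ?t = real n" using n by simp_all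
  have "measure_pmf.expectation ?R (\<lambda>xz. max 0 (r - sqrt (info_variance p) *
        ((\<Sum>v\<leftarrow>xz. cond_info p v - ?H) / sqrt (real n * info_variance p))))
    \<le> measure_pmf.expectation ?R (\<lambda>xz. 1 / ?t * max 0 (ln (real m) - (\<Sum>v\<leftarrow>xz. cond_info p v)))"
  proof (rule integral_mono_AE)
    show "AE xz in ?R. max 0 (r - sqrt (info_variance p) *
          ((\<Sum>v\<leftarrow>xz. cond_info p v - ?H) / sqrt (real n * info_variance p)))
        \<le> 1 / ?t * max 0 (ln (real m) - (\<Sum>v\<leftarrow>xz. cond_info p v))"
    proof (rule AE_pmfI)
      fix xz assume "xz \<in> set_pmf ?R"
      \<comment> \<open>Every list in the support has length \<open>n\<close>, so centring each
        entry removes \<open>real n * ?H\<close> in total.\<close>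
      then have "(\<Sum>v\<leftarrow>xz. cond_info p v - ?H) = (\<Sum>v\<leftarrow>xz. cond_info p v) - real n * ?H"
        by (auto simp: set_replicate_pmf sum_list_subtractf sum_list_triv)
      then have "sqrt (info_variance p) * ((\<Sum>v\<leftarrow>xz. cond_info p v - ?H) / sqrt (real n * info_variance p)) =
          ((\<Sum>v\<leftarrow>xz. cond_info p v) - real n * ?H) / ?t"
        using var by (simp add: real_sqrt_mult)
      moreover have "ln (real m / exp (real n * ?H)) = ln (real m) - real n * ?H"
        using m by (simp add: ln_div)
      ultimately have "r - sqrt (info_variance p) *
          ((\<Sum>v\<leftarrow>xz. cond_info p v - ?H) / sqrt (real n * info_variance p))
          \<le> 1 / ?t * (ln (real m) - (\<Sum>v\<leftarrow>xz. cond_info p v))"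
        using r by (simp add: diff_divide_distrib)
      moreover have "1 / ?t * max 0 x = max 0 (1 / ?t * x)" for x
        using t by (simp add: max_def zero_le_divide_iff)
      ultimately show "max 0 (r - sqrt (info_variance p) *
          ((\<Sum>v\<leftarrow>xz. cond_info p v - ?H) / sqrt (real n * info_variance p)))
          \<le> 1 / ?t * max 0 (ln (real m) - (\<Sum>v\<leftarrow>xz. cond_info p v))"
        by (metis max.mono order_refl)
    qed
  qed (intro integrable_measure_pmf_finite finite_set_replicate_pmf)+
  also have "\<dots> = 1 / ?t * measure_pmf.expectation ?R (\<lambda>xz. max 0 (ln (real m) - (\<Sum>v\<leftarrow>xz. cond_info p v)))"
    by (rule integral_mult_right_zero)
  also have "\<dots> \<le> 1 / ?t * (hash_divergence p n m f + 1)"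
    using hash_divergence_ge[where n = n and f = f and p = p, OF m f] t
    by (intro mult_left_mono) auto
  finally show ?thesis by (simp add: add_divide_distrib)
qed

text \<open>Two limits are taken in order: first in \<open>n\<close> at a fixed cap
  \<open>k\<close>, by the central limit theorem, then in \<open>k\<close>. The strict inequality on
  \<open>r\<close> makes the normalized log-size exceed \<open>r\<close> for all large
  \<open>n\<close>, so the constant \<open>r\<close> can replace it.\<close>

lemma liminf_hash_divergence_ge:
  fixes p :: "('a::finite \<times> 'b::finite) pmf"
  assumes var: "info_variance p > 0"
    and M_pos: "\<And>n. n \<ge> 1 \<Longrightarrow> M n > 0"
    and f_range: "\<And>n xs. n \<ge> 1 \<Longrightarrow> length xs = n \<Longrightarrow> f n xs \<in> {1..M n}"
    and r: "ereal r < liminf (\<lambda>n. ereal (1 / sqrt (real n) *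
                  ln (real (M n) / exp (real n * cond_entropy p))))"
  shows "ereal (normal_shortfall (sqrt (info_variance p)) r) \<le>
    liminf (\<lambda>n. ereal (1 / sqrt (real n) * hash_divergence p n (M n) (f n)))"
proof -
  let ?\<sigma> = "sqrt (info_variance p)"
  let ?H = "cond_entropy p"
  define U where "U n xz = (\<Sum>v\<leftarrow>xz. cond_info p v - ?H) / sqrt (real n * info_variance p)" for n xz
  define \<phi> where "\<phi> k u = min (real k) (max 0 (r - ?\<sigma> * u))" for k u
  have inv_sqrt: "(\<lambda>n. 1 / sqrt (real n)) \<longlonglongrightarrow> 0"
    by real_asymp
  have [measurable]: "\<phi> k \<in> borel_measurable borel" for k
    unfolding \<phi>_def[abs_def] by measurable
  have "weak_conv_m (\<lambda>n. distr (replicate_pmf n p) borel (U n)) std_normal_distribution"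
    using central_limit_theorem_replicate_pmf[of p "cond_info p"] var
    unfolding U_def cond_entropy_eq_expectation info_variance_def cond_info_def[symmetric] by simp
  moreover have "real_distribution (distr (replicate_pmf n p) borel (U n))" for n
    by (simp add: real_distribution_def real_distribution_axioms_def measure_pmf.prob_space_distr)
  moreover have "isCont (\<phi> k) u" for k u
    unfolding \<phi>_def[abs_def] by (intro continuous_intros)
  moreover have "norm (\<phi> k u) \<le> real k" for k u
    by (simp add: \<phi>_def)
  ultimately have "(\<lambda>n. integral\<^sup>L (distr (replicate_pmf n p) borel (U n)) (\<phi> k)) \<longlonglongrightarrow>
      integral\<^sup>L std_normal_distribution (\<phi> k)" for k
    by (intro weak_conv_imp_integral_bdd_continuous_conv[where B = "real k"] real_dist_normal_dist)
  then have lim: "(\<lambda>n. measure_pmf.expectation (replicate_pmf n p) (\<lambda>xz. \<phi> k (U n xz)) - 1 / sqrt (real n))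
      \<longlonglongrightarrow> integral\<^sup>L std_normal_distribution (\<phi> k)" for k
    using tendsto_diff[OF _ inv_sqrt] by (fastforce simp: integral_distr)
  have "ereal (integral\<^sup>L std_normal_distribution (\<phi> k)) \<le>
    liminf (\<lambda>n. ereal (1 / sqrt (real n) * hash_divergence p n (M n) (f n)))" for k
  proof -
    have "ereal (integral\<^sup>L std_normal_distribution (\<phi> k)) =
        liminf (\<lambda>n. ereal (measure_pmf.expectation (replicate_pmf n p) (\<lambda>xz. \<phi> k (U n xz)) - 1 / sqrt (real n)))"
      using lim[of k] by (intro lim_imp_Liminf[symmetric]) auto
    also have "\<dots> \<le> liminf (\<lambda>n. ereal (1 / sqrt (real n) * hash_divergence p n (M n) (f n)))"
    proof (rule Liminf_mono)
      have "\<forall>\<^sub>F n in sequentially. ereal r < ereal (1 / sqrt (real n) *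
          ln (real (M n) / exp (real n * ?H)))"
        using r by (rule less_LiminfD)
      \<comment> \<open>Index 0 is discarded, since the assumptions on \<open>M\<close> and
        \<open>f\<close> start at 1.\<close>
      with eventually_gt_at_top[of 0]
      show "\<forall>\<^sub>F n in sequentially.
          ereal (measure_pmf.expectation (replicate_pmf n p) (\<lambda>xz. \<phi> k (U n xz)) - 1 / sqrt (real n))
          \<le> ereal (1 / sqrt (real n) * hash_divergence p n (M n) (f n))"
      proof eventually_elim
        case (elim n)
        have "measure_pmf.expectation (replicate_pmf n p) (\<lambda>xz. \<phi> k (U n xz)) \<le>
            measure_pmf.expectation (replicate_pmf n p) (\<lambda>xz. max 0 (r - ?\<sigma> * U n xz))"
          by (intro integral_mono integrable_measure_pmf_finite finite_set_replicate_pmf) (simp add: \<phi>_def)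
        also have "\<dots> - 1 / sqrt (real n) \<le> 1 / sqrt (real n) * hash_divergence p n (M n) (f n)"
          unfolding U_def using elim M_pos f_range
          by (intro hash_divergence_normalized_ge var) auto
        finally show ?case by simp
      qed
    qed
    finally show ?thesis .
  qed
  \<comment> \<open>The bound holds at every cap with a right-hand side free of \<open>k\<close>, so
    it survives this limit.\<close>
  moreover have "(\<lambda>k. ereal (integral\<^sup>L std_normal_distribution (\<phi> k))) \<longlonglongrightarrow> ereal (normal_shortfall ?\<sigma> r)"
    using normal_shortfall_truncated_tendsto[of r ?\<sigma>] by (simp add: \<phi>_def[abs_def])
  ultimately show ?thesis
    by (intro LIMSEQ_le_const2[where X = "\<lambda>k. ereal (integral\<^sup>L std_normal_distribution (\<phi> k))"]) auto
qed

theorem theorem6: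
  fixes p :: "('a::finite \<times> 'b::finite) pmf"
    and M :: "nat \<Rightarrow> nat"
    and f :: "nat \<Rightarrow> 'a list \<Rightarrow> nat"
    and \<sigma> :: real and b :: ereal
  assumes var_pos: "info_variance p > 0"
    and sigma: "\<sigma> = sqrt (info_variance p)"
    and M_pos: "\<And>n. n \<ge> 1 \<Longrightarrow> M n > 0"
    and f_range: "\<And>n xs. n \<ge> 1 \<Longrightarrow> length xs = n \<Longrightarrow> f n xs \<in> {1..M n}"
    and rate: "(\<lambda>n. 1 / real n * ln (real (M n))) \<longlonglongrightarrow> cond_entropy p"
    and b: "b = liminf (\<lambda>n. ereal (1 / sqrt (real n) *
                  ln (real (M n) / exp (real n * cond_entropy p))))"
  shows "liminf (\<lambda>n. ereal (1 / sqrt (real n) * hash_divergence p n (M n) (f n)))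
    \<ge> (case b of
          ereal r \<Rightarrow> ereal (LINT u:{..r / \<sigma>}|lborel. (r - \<sigma> * u) * std_normal_density u)
        | PInfty \<Rightarrow> \<infinity>
        | MInfty \<Rightarrow> 0)"
proof -
  let ?L = "liminf (\<lambda>n. ereal (1 / sqrt (real n) * hash_divergence p n (M n) (f n)))"
  have \<sigma>_pos: "\<sigma> > 0" using var_pos sigma by simp
  have below: "ereal (normal_shortfall \<sigma> r) \<le> ?L" if "ereal r < b" for r
    unfolding sigma by (rule liminf_hash_divergence_ge[OF var_pos M_pos f_range])
      (use that b in simp_all)
  show ?thesis
  proof (cases b)
    case (real r)
    \<comment> \<open>The bound is available only strictly below \<open>b\<close>, so it is applied
      at \<open>r - e\<close> and the loss \<open>e\<close> is removed afterwards.\<close>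
    have "ereal (normal_shortfall \<sigma> r) \<le> ?L"
    proof (rule ereal_le_epsilon2)
      fix e :: real assume e: "e > 0"
      have "ereal (normal_shortfall \<sigma> r) \<le> ereal (normal_shortfall \<sigma> (r - e)) + ereal e"
        using normal_shortfall_diff_ge[of e \<sigma> r] e by simp
      also have "\<dots> \<le> ?L + ereal e"
        using e real by (intro add_right_mono below) simp
      finally show "ereal (normal_shortfall \<sigma> r) \<le> ?L + ereal e" .
    qed
    then show ?thesis by (simp add: real normal_shortfall_eq[OF \<sigma>_pos])
  next
    case PInf
    have "ereal r \<le> ?L" for r
    proof -
      have "ereal r \<le> ereal (normal_shortfall \<sigma> r)"
        by (simp add: normal_shortfall_ge)
      also have "\<dots> \<le> ?L"
        using PInf by (intro below) simp
      finally show ?thesis .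
    qed
    then have "?L = \<infinity>" by (rule ereal_top)
    then show ?thesis by simp
  next
    case MInf
    \<comment> \<open>No real threshold lies below \<open>b\<close> here. Dropping the positive part
      leaves a divergence of at least \<open>- 1\<close>, which vanishes after division by
      \<open>sqrt (real n)\<close>.\<close>
    have "(\<lambda>n. - 1 / sqrt (real n)) \<longlonglongrightarrow> 0" by real_asymp
    then have "0 = liminf (\<lambda>n. ereal (- 1 / sqrt (real n)))"
      by (intro lim_imp_Liminf[symmetric]) (auto simp: zero_ereal_def)
    also have "\<dots> \<le> ?L"
    proof (rule Liminf_mono, rule eventually_mono[OF eventually_ge_at_top[of 1]])
      fix n :: nat assume n: "n \<ge> 1"
      have "0 \<le> measure_pmf.expectation (replicate_pmf n p)
          (\<lambda>xz. max 0 (ln (real (M n)) - (\<Sum>v\<leftarrow>xz. cond_info p v)))"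
        by (intro Bochner_Integration.integral_nonneg) simp
      also have "\<dots> \<le> hash_divergence p n (M n) (f n) + 1"
        using hash_divergence_ge[where n = n and f = "f n" and p = p, OF M_pos[OF n] f_range[OF n]]
        by simp
      finally have "- 1 \<le> hash_divergence p n (M n) (f n)" by simp
      then have "- 1 / sqrt (real n) \<le> hash_divergence p n (M n) (f n) / sqrt (real n)"
        by (rule divide_right_mono) simp
      then show "ereal (- 1 / sqrt (real n)) \<le>
          ereal (1 / sqrt (real n) * hash_divergence p n (M n) (f n))"
        by simp
    qed
    finally show ?thesis by (simp add: MInf)
  qed
qed

end
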